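(* Let $\mathcal X$ and $\mathcal Y$ be Banach spaces and let $\mathcal R$ be a penalty functional for which there exist constants $C_\Delta>0$ and $r>1$ such that $C_\Delta\|f_1-f_2\|_{\mathcal X}^r\le\Delta_{\mathcal R}(f_2,f_1)$ for all $f_1,f_2\in\mathcal X$. Let $f^\dagger\in\mathcal D$ and $f^*\in\partial\mathcal R(f^\dagger)$. Suppose that there exist an index set $J$, a family of operators $P_j:\mathcal X^*\to\mathcal X^*$, $j\in J$, functions $\kappa,\sigma:J\to(0,\infty)$ and a constant $\gamma\ge0$ such that $\inf_{j\in J}\kappa(j)=0$ and for all $j\in J$: $$\|(I-P_j)f^*\|_{\mathcal X^*}\le\kappa(j),$$ $$\langle P_jf^*,f^\dagger-f\rangle\le\sigma(j)\,\|F(f^\dagger)-F(f)\|_{\mathcal Y}+\gamma\,\kappa(j)\,\|f^\dagger-f\|_{\mathcal X}$$ for all $f\in\mathcal D$ with $\|f^\dagger-f\|_{\mathcal X}\le\big(\tfrac{2}{C_\Delta}\|f^*\|_{\mathcal X^*}\big)^{r'/r}$. Then $f^\dagger$ fulfills the variational source condition $$\langle f^*,f^\dagger-f\rangle\le\tfrac12\Delta_{\mathcal R}(f,f^\dagger)+\psi_{\mathrm{vsc}}\big(\|F(f^\dagger)-F(f)\|_{\mathcal Y}^t\big)\qquad\text{for all } f\in\mathcal D$$ with the concave index function $$\psi_{\mathrm{vsc}}(\tau)=\inf_{j\in J}\Big[\sigma(j)\,\tau^{1/t}+\tfrac1{r'}\big(\tfrac{2}{C_\Delta}\big)^{r'/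r}(1+\gamma)^{r'}\kappa(j)^{r'}\Big].$$
   Context: $\mathcal D\subset\mathcal X$ is a nonempty, closed, convex set, $F:\mathcal D\to\mathcal Y$ is the forward operator, $t\ge1$ is fixed, $r'$ is the Hölder conjugate of $r$ ($1/r+1/r'=1$), $\mathcal X^*$ is the dual of $\mathcal X$. $\mathcal R:\mathcal X\to(-\infty,\infty]$ is convex and (as throughout the paper) differentiable, so subgradients are unique; the Bregman distance is $\Delta_{\mathcal R}(f,h)=\mathcal R(f)-\mathcal R(h)-\langle h^*,f-h\rangle$ with $h^*\in\partial\mathcal R(h)$. A concave index function is a function $\psi:[0,\infty)\to[0,\infty)$ that is concave, continuous, increasing (in the non-strict sense) and satisfies $\psi(0)=0$. *)

theory Defs
  imports "HOL-Analysis.Analysis"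
begin

text \<open>
  The dual of a real Banach space \<open>'x\<close> is the type of bounded linear functionals
  \<open>'x \<Rightarrow>\<^sub>L real\<close> with the operator norm. Penalty functionals with values in
  \<open>(-\<infinity>, \<infinity>]\<close> are functions into \<^typ>\<open>ereal\<close> that never take the value \<open>-\<infinity>\<close>.
\<close>

text \<open>For functionals avoiding \<open>-\<infinity>\<close>, the right-hand side below contains no \<open>\<infinity> - \<infinity>\<close>,
  and \<open>0 * \<infinity> = 0\<close> makes the cases \<open>u = 0\<close> and \<open>u = 1\<close> trivial.\<close>

definition convex_functional :: "('x::real_vector \<Rightarrow> ereal) \<Rightarrow> bool" where
  "convex_functional R \<longleftrightarrow>
     (\<forall>f g. \<forall>u\<in>{0..1::real}.
        R ((1 - u) *\<^sub>R f + u *\<^sub>R g) \<le> ereal (1 - u) * R f + ereal u * R g)"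

text \<open>By convention the subdifferential is empty where \<open>R\<close> is infinite.\<close>

definition subdifferential ::
    "('x::real_normed_vector \<Rightarrow> ereal) \<Rightarrow> 'x \<Rightarrow> ('x \<Rightarrow>\<^sub>L real) set" where
  "subdifferential R h =
     {g. \<bar>R h\<bar> \<noteq> \<infinity> \<and> (\<forall>f. R h + ereal (blinfun_apply g (f - h)) \<le> R f)}"

text \<open>Gateaux differentiability at a point of finiteness. The difference quotients are taken
  in \<^typ>\<open>ereal\<close>, so convergence to a real number forces \<open>R\<close> to be finite at all points of
  each line through \<open>h\<close> that are close enough to \<open>h\<close>.\<close>

definition gateaux_differentiable_at ::
    "('x::real_normed_vector \<Rightarrow> ereal) \<Rightarrow> 'x \<Rightarrow> bool" where
  "gateaux_differentiable_at R h \<longleftrightarrow>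
     \<bar>R h\<bar> \<noteq> \<infinity> \<and>
     (\<exists>g :: 'x \<Rightarrow>\<^sub>L real. \<forall>v.
        ((\<lambda>s::real. (R (h + s *\<^sub>R v) - R h) / ereal s)
            \<longlongrightarrow> ereal (blinfun_apply g v)) (at 0))"

text \<open>Penalty functionals need only be differentiable where they have a subgradient, that is,
  where the Bregman distance to the point is defined. This covers functionals that are
  differentiable everywhere (hence finite), those that are differentiable on their effective
  domain, and Legendre-type functionals without subgradients on the boundary of the domain.\<close>

definition penalty_functional :: "('x::real_normed_vector \<Rightarrow> ereal) \<Rightarrow> bool" where
  "penalty_functional R \<longleftrightarrow>
     (\<forall>f. R f \<noteq> -\<infinity>) \<and> convex_functional R \<and>
     (\<forall>h. subdifferential R h \<noteq> {} \<longrightarrow> gateaux_differentiable_at R h)"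

lemma subgradient_eq_gateaux:
  fixes R :: "'x::real_normed_vector \<Rightarrow> ereal" and g k :: "'x \<Rightarrow>\<^sub>L real"
  assumes g: "g \<in> subdifferential R h"
    and k: "((\<lambda>s::real. (R (h + s *\<^sub>R v) - R h) / ereal s)
              \<longlongrightarrow> ereal (blinfun_apply k v)) (at 0)"
  shows "blinfun_apply g v = blinfun_apply k v"
proof -
  let ?q = "\<lambda>s::real. (R (h + s *\<^sub>R v) - R h) / ereal s"
  obtain c where c: "R h = ereal c"
    using g by (cases "R h") (auto simp: subdifferential_def)
  have sub: "ereal (s * blinfun_apply g v) \<le> R (h + s *\<^sub>R v) - R h" for s
  proof -
    have "R h + ereal (blinfun_apply g (h + s *\<^sub>R v - h)) \<le> R (h + s *\<^sub>R v)"
      using g unfolding subdifferential_def by blast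
    then show ?thesis
      by (cases "R (h + s *\<^sub>R v)") (auto simp: c blinfun.scaleR_right)
  qed
  have pos: "ereal (blinfun_apply g v) \<le> ?q s" if "s > 0" for s
    using sub[of s] that
    by (cases "R (h + s *\<^sub>R v)") (auto simp: c divide_ereal_def field_simps)
  have neg: "?q s \<le> ereal (blinfun_apply g v)" if "s < 0" for s
    using sub[of s] that
    by (cases "R (h + s *\<^sub>R v)") (auto simp: c divide_ereal_def field_simps)
  have "ereal (blinfun_apply g v) \<le> ereal (blinfun_apply k v)"
  proof (rule tendsto_lowerbound)
    show "(?q \<longlongrightarrow> ereal (blinfun_apply k v)) (at_right 0)"
      using k by (rule filterlim_mono) (auto simp: at_within_le_at)
    show "\<forall>\<^sub>F s in at_right 0. ereal (blinfun_apply g v) \<le> ?q s"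
      using pos by (auto simp: eventually_at_right_field intro: exI[of _ 1])
  qed simp
  moreover have "ereal (blinfun_apply k v) \<le> ereal (blinfun_apply g v)"
  proof (rule tendsto_upperbound)
    show "(?q \<longlongrightarrow> ereal (blinfun_apply k v)) (at_left 0)"
      using k by (rule filterlim_mono) (auto simp: at_within_le_at)
    show "\<forall>\<^sub>F s in at_left 0. ?q s \<le> ereal (blinfun_apply g v)"
      using neg by (auto simp: eventually_at_left_field intro: exI[of _ "-1"])
  qed simp
  ultimately show ?thesis by simp
qed

lemma subgradient_unique:
  assumes "penalty_functional R" and "g \<in> subdifferential R h" and "g' \<in> subdifferential R h"
  shows "g = g'"
proof -
  obtain k :: "'a \<Rightarrow>\<^sub>L real" where
    k: "\<And>v. ((\<lambda>s::real. (R (h + s *\<^sub>R v) - R h) / ereal s)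
          \<longlongrightarrow> ereal (blinfun_apply k v)) (at 0)"
    using assms unfolding penalty_functional_def gateaux_differentiable_at_def by blast
  show ?thesis
    using subgradient_eq_gateaux[OF assms(2) k] subgradient_eq_gateaux[OF assms(3) k]
    by (intro blinfun_eqI) simp
qed

text \<open>Meaningful only if \<open>R\<close> has a subgradient at \<open>h\<close>; for penalty functionals it is then
  unique. The value is \<open>\<infinity>\<close> if \<open>R f = \<infinity>\<close>.\<close>

definition bregman_distance ::
    "('x::real_normed_vector \<Rightarrow> ereal) \<Rightarrow> 'x \<Rightarrow> 'x \<Rightarrow> ereal" where
  "bregman_distance R f h =
     R f - R h - ereal (blinfun_apply (THE g. g \<in> subdifferential R h) (f - h))"

lemma bregman_distance_eq:
  assumes "penalty_functional R" and "g \<in> subdifferential R h"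
  shows "bregman_distance R f h = R f - R h - ereal (blinfun_apply g (f - h))"
proof -
  have "(THE g. g \<in> subdifferential R h) = g"
    using assms subgradient_unique by blast
  then show ?thesis by (simp add: bregman_distance_def)
qed

definition concave_index_function :: "(real \<Rightarrow> real) \<Rightarrow> bool" where
  "concave_index_function \<psi> \<longleftrightarrow>
     (\<forall>\<tau>\<ge>0. 0 \<le> \<psi> \<tau>) \<and> concave_on {0..} \<psi> \<and> continuous_on {0..} \<psi> \<and>
     mono_on {0..} \<psi> \<and> \<psi> 0 = 0"

definition psi_vsc ::
    "'j set \<Rightarrow> ('j \<Rightarrow> real) \<Rightarrow> ('j \<Rightarrow> real) \<Rightarrow> real \<Rightarrow> real \<Rightarrow> real \<Rightarrow> real \<Rightarrow> real \<Rightarrow> real \<Rightarrow> real" where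
  "psi_vsc J \<kappa> \<sigma> \<gamma> C r r' t \<tau> =
     (INF j\<in>J. \<sigma> j * \<tau> powr (1 / t)
               + 1 / r' * (2 / C) powr (r' / r) * (1 + \<gamma>) powr r' * \<kappa> j powr r')"

end

theory Submission imports Defs begin

text \<open>
  If \<open>\<parallel>fdag - f\<parallel>\<close> exceeds the radius in the hypothesis on \<open>P\<close>, then the coercivity of the Bregman
  distance alone gives \<open>\<langle>fstar, fdag - f\<rangle> \<le> \<parallel>fstar\<parallel> \<parallel>fdag - f\<parallel> \<le> 1/2 C \<parallel>fdag - f\<parallel>\<^sup>r\<close>.
  Otherwise split \<open>fstar = (fstar - P j fstar) + P j fstar\<close>; the resulting term
  \<open>(1 + \<gamma>) \<kappa> j \<parallel>fdag - f\<parallel>\<close> is absorbed by Young's inequality. Taking the infimum over \<open>j\<close>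
  gives \<open>\<psi>\<close>, an infimum of concave functions of \<open>\<tau>\<close>; its value and
  continuity at \<open>0\<close> come from \<open>inf \<kappa> = 0\<close>.
\<close>

text \<open>Weighted AM-GM with weights \<open>p\<close> and \<open>1 - p\<close> puts the power
  function below its tangent at the convex combination \<open>m\<close>; this tangent bound, cleared
  of the negative power of \<open>m\<close>, is then averaged over \<open>x\<close> and
  \<open>y\<close>.\<close>

lemma powr_concave:
  fixes p :: real
  assumes "0 < p" "p \<le> 1"
  shows "concave_on {0..} (\<lambda>x. x powr p)"
  unfolding concave_on_iff
proof (intro conjI ballI allI impI)
  show "convex {0::real..}" by simp
next
  fix x y u v :: real
  assume xy: "x \<in> {0..}" "y \<in> {0..}" and uv: "0 \<le> u" "0 \<le> v" "u + v = 1"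
  define m where "m = u * x + v * y"
  have "u * x powr p + v * y powr p \<le> m powr p"
  proof (cases "m > 0")
    case True
    have tangent: "z powr p * m powr (1 - p) \<le> p * z + (1 - p) * m" if "z \<ge> 0" for z
      using Youngs_inequality_0[of p "1 - p" z m] that True assms
      by (cases "z = 0") auto
    have "(u * x powr p + v * y powr p) * m powr (1 - p)
        = u * (x powr p * m powr (1 - p)) + v * (y powr p * m powr (1 - p))"
      by (simp add: algebra_simps)
    also have "\<dots> \<le> u * (p * x + (1 - p) * m) + v * (p * y + (1 - p) * m)"
      using tangent xy uv by (intro add_mono mult_left_mono) auto
    also have "\<dots> = p * m + (u + v) * ((1 - p) * m)"
      by (simp add: m_def algebra_simps)
    also have "\<dots> = m" by (simp add: uv(3) algebra_simps)
    also have "\<dots> = m powr p * m powr (1 - p)"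
      using True by (simp flip: powr_add)
    finally show ?thesis using True by simp
  next
    \<comment> \<open>Now \<open>m = 0\<close>, so in each summand the weight or the point is zero,
      and \<open>0 powr p = 0\<close> makes the left side vanish.\<close>
    case False
    moreover have "0 \<le> u * x" "0 \<le> v * y" using xy uv by auto
    ultimately have "u * x = 0" "v * y = 0" unfolding m_def by linarith+
    then show ?thesis using assms by auto
  qed
  then show "u * x powr p + v * y powr p \<le> (u *\<^sub>R x + v *\<^sub>R y) powr p"
    by (simp add: m_def)
qed

text \<open>Boundedness below makes both infima genuine lower bounds, so they can be compared with
  the values of one common member \<open>\<phi> j\<close>, whose concavity finishes the
  argument.\<close>

lemma concave_on_INF:
  fixes \<phi> :: "'j \<Rightarrow> 'a::real_vector \<Rightarrow> real"
  assumes "J \<noteq> {}" "\<And>j. j \<in> J \<Longrightarrow> concave_on S (\<phi> j)"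
    and "\<And>x. x \<in> S \<Longrightarrow> bdd_below ((\<lambda>j. \<phi> j x) ` J)"
  shows "concave_on S (\<lambda>x. INF j\<in>J. \<phi> j x)"
  unfolding concave_on_iff
proof (intro conjI ballI allI impI)
  show "convex S" using assms concave_on_imp_convex by blast
next
  fix x y and u v :: real
  assume *: "x \<in> S" "y \<in> S" "0 \<le> u" "0 \<le> v" "u + v = 1"
  show "u * (INF j\<in>J. \<phi> j x) + v * (INF j\<in>J. \<phi> j y) \<le> (INF j\<in>J. \<phi> j (u *\<^sub>R x + v *\<^sub>R y))"
  proof (rule cINF_greatest[OF assms(1)])
    fix j assume j: "j \<in> J"
    have "u * (INF j\<in>J. \<phi> j x) + v * (INF j\<in>J. \<phi> j y) \<le> u * \<phi> j x + v * \<phi> j y"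
      using * j assms(3) by (intro add_mono mult_left_mono cINF_lower) auto
    also have "\<dots> \<le> \<phi> j (u *\<^sub>R x + v *\<^sub>R y)"
      using assms(2)[OF j] * by (auto simp: concave_on_iff)
    finally show "u * (INF j\<in>J. \<phi> j x) + v * (INF j\<in>J. \<phi> j y) \<le> \<phi> j (u *\<^sub>R x + v *\<^sub>R y)" .
  qed
qed

text \<open>Continuity does not pass to infima in general. At interior points it follows from
  concavity; at \<open>0\<close> the infimum is squeezed between \<open>0\<close> and a single
  continuous member with \<open>\<phi> j 0 < e\<close>.\<close>

lemma concave_index_function_INF:
  fixes \<phi> :: "'j \<Rightarrow> real \<Rightarrow> real"
  assumes "J \<noteq> {}"
    and conc: "\<And>j. j \<in> J \<Longrightarrow> concave_on {0..} (\<phi> j)"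
    and cont: "\<And>j. j \<in> J \<Longrightarrow> continuous_on {0..} (\<phi> j)"
    and mono: "\<And>j. j \<in> J \<Longrightarrow> mono_on {0..} (\<phi> j)"
    and nonneg: "\<And>j x. j \<in> J \<Longrightarrow> 0 \<le> x \<Longrightarrow> 0 \<le> \<phi> j x"
    and small: "\<And>e. 0 < e \<Longrightarrow> \<exists>j\<in>J. \<phi> j 0 < e"
  shows "concave_index_function (\<lambda>x. INF j\<in>J. \<phi> j x)"
proof -
  let ?\<psi> = "\<lambda>x. INF j\<in>J. \<phi> j x"
  have bdd: "bdd_below ((\<lambda>j. \<phi> j x) ` J)" if "0 \<le> x" for x
    using nonneg that by (intro bdd_belowI2[of _ 0]) auto
  have lower: "?\<psi> x \<le> \<phi> j x" if "0 \<le> x" "j \<in> J" for x j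
    using bdd that by (intro cINF_lower) auto
  have pos: "0 \<le> ?\<psi> x" if "0 \<le> x" for x
    using nonneg that \<open>J \<noteq> {}\<close> by (intro cINF_greatest) auto
  have conc': "concave_on {0..} ?\<psi>"
    using \<open>J \<noteq> {}\<close> conc bdd by (intro concave_on_INF) auto
  have zero: "?\<psi> 0 = 0"
  proof (rule antisym)
    show "?\<psi> 0 \<le> 0"
    proof (rule field_le_epsilon)
      fix e :: real assume "0 < e"
      then obtain j where "j \<in> J" "\<phi> j 0 < e" using small by blast
      then show "?\<psi> 0 \<le> 0 + e" using lower[of 0 j] by simp
    qed
  qed (use pos in simp)
  have "continuous_on {0..} ?\<psi>"
    unfolding continuous_on_def
  proof
    fix x :: real assume "x \<in> {0..}"
    then consider "x > 0" | "x = 0" by fastforce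
    then show "(?\<psi> \<longlongrightarrow> ?\<psi> x) (at x within {0..})"
    proof cases
      case 1
      have "convex_on {0<..} (\<lambda>x. - ?\<psi> x)"
        using conc' unfolding concave_on_def by (rule convex_on_subset) auto
      then have "continuous_on {0<..} (\<lambda>x. - (- ?\<psi> x))"
        by (intro continuous_on_minus convex_on_continuous) auto
      then have "isCont ?\<psi> x"
        using 1 by (simp add: continuous_on_eq_continuous_at)
      then show ?thesis
        unfolding isCont_def by (rule tendsto_within_subset) simp
    next
      case 2
      have ge0: "\<forall>\<^sub>F x in at 0 within {0..}. (0::real) \<le> x"
        by (simp add: eventually_at_filter)
      have "(?\<psi> \<longlongrightarrow> 0) (at 0 within {0..})"
      proof (rule order_tendstoI)
        fix e :: real assume "e < 0"
        from ge0 show "\<forall>\<^sub>F x in at 0 within {0..}. e < ?\<psi> x"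
          by eventually_elim (use \<open>e < 0\<close> pos less_le_trans in blast)
      next
        fix e :: real assume "0 < e"
        then obtain j where j: "j \<in> J" "\<phi> j 0 < e" using small by blast
        have "(\<phi> j \<longlongrightarrow> \<phi> j 0) (at 0 within {0..})"
          using cont[OF j(1)] by (simp add: continuous_on_def)
        then have "\<forall>\<^sub>F x in at 0 within {0..}. \<phi> j x < e"
          using j(2) order_tendstoD(2) by blast
        from ge0 this show "\<forall>\<^sub>F x in at 0 within {0..}. ?\<psi> x < e"
          by eventually_elim (use lower j(1) le_less_trans in blast)
      qed
      then show ?thesis using 2 zero by simp
    qed
  qed
  moreover have "mono_on {0..} ?\<psi>"
  proof (rule mono_onI)
    fix x y :: real assume "x \<in> {0..}" "y \<in> {0..}" "x \<le> y"
    then have "\<phi> j x \<le> \<phi> j y" if "j \<in> J" for j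
      using mono_onD[OF mono[OF that]] by blast
    then show "?\<psi> x \<le> ?\<psi> y"
      using \<open>J \<noteq> {}\<close> bdd \<open>x \<in> {0..}\<close> by (intro cINF_mono) auto
  qed
  ultimately show ?thesis
    unfolding concave_index_function_def using pos conc' zero by auto
qed

text \<open>Young's inequality for \<open>c powr (1 / p) * b\<close> and
  \<open>a * c powr (- 1 / p)\<close>, whose product is \<open>a * b\<close>. The gain
  \<open>1 / p\<close> in the first term is given away, which yields the constant of
  \<open>psi_vsc\<close> when \<open>c = C / 2\<close>.\<close>

lemma Youngs_inequality_scaled:
  fixes p q c a b :: real
  assumes "p > 1" "q > 1" "1 / p + 1 / q = 1" "c > 0" "a \<ge> 0" "b \<ge> 0"
  shows "a * b \<le> c * b powr p + 1 / q * (1 / c) powr (q / p) * a powr q"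
proof -
  have "(a * c powr (- 1 / p)) * (c powr (1 / p) * b)
      \<le> (c powr (1 / p) * b) powr p / p + (a * c powr (- 1 / p)) powr q / q"
    using Youngs_inequality[of p q "c powr (1 / p) * b" "a * c powr (- 1 / p)"] assms
    by (simp add: mult.commute)
  moreover have "(a * c powr (- 1 / p)) * (c powr (1 / p) * b) = a * b"
    using \<open>c > 0\<close> by (simp add: powr_minus)
  moreover have "(c powr (1 / p) * b) powr p = c * b powr p"
    using assms by (simp add: powr_mult powr_powr)
  moreover have "(a * c powr (- 1 / p)) powr q = (1 / c) powr (q / p) * a powr q"
    using assms by (simp add: powr_mult powr_powr powr_divide powr_minus field_simps)
  moreover have "c * b powr p / p \<le> c * b powr p"
    using assms divide_left_mono[of 1 p "c * b powr p"] by simp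
  ultimately show ?thesis by (simp only: times_divide_eq_left mult_1_left)
qed

theorem theorem3p3:
  fixes D :: "'x::banach set"
    and F :: "'x \<Rightarrow> 'y::banach"
    and R :: "'x \<Rightarrow> ereal"
    and fdag :: 'x
    and fstar :: "'x \<Rightarrow>\<^sub>L real"
    and J :: "'j set"
    and P :: "'j \<Rightarrow> ('x \<Rightarrow>\<^sub>L real) \<Rightarrow> ('x \<Rightarrow>\<^sub>L real)"
    and \<kappa> \<sigma> :: "'j \<Rightarrow> real"
    and \<gamma> C r r' t :: real
  assumes "D \<noteq> {}" and "closed D" and "convex D"
    and "t \<ge> 1"
    and "penalty_functional R"
    and "C > 0" and "r > 1" and "1 / r + 1 / r' = 1"
    and "\<And>f1 f2. subdifferential R f1 \<noteq> {} \<Longrightarrow>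
           ereal (C * norm (f1 - f2) powr r) \<le> bregman_distance R f2 f1"
    and "fdag \<in> D" and "fstar \<in> subdifferential R fdag"
    and "\<And>j. j \<in> J \<Longrightarrow> \<kappa> j > 0" and "\<And>j. j \<in> J \<Longrightarrow> \<sigma> j > 0" and "\<gamma> \<ge> 0"
    and "J \<noteq> {}" and "(INF j\<in>J. \<kappa> j) = 0"
    and "\<And>j. j \<in> J \<Longrightarrow> norm (fstar - P j fstar) \<le> \<kappa> j"
    and "\<And>j f. j \<in> J \<Longrightarrow> f \<in> D \<Longrightarrow>
           norm (fdag - f) \<le> (2 / C * norm fstar) powr (r' / r) \<Longrightarrow>
           blinfun_apply (P j fstar) (fdag - f)
             \<le> \<sigma> j * norm (F fdag - F f) + \<gamma> * \<kappa> j * norm (fdag - f)"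
  shows "(\<forall>f\<in>D. ereal (blinfun_apply fstar (fdag - f))
             \<le> ereal (1 / 2) * bregman_distance R f fdag
                + ereal (psi_vsc J \<kappa> \<sigma> \<gamma> C r r' t (norm (F fdag - F f) powr t)))
         \<and> concave_index_function (psi_vsc J \<kappa> \<sigma> \<gamma> C r r' t)"
proof -
  have J: "J \<noteq> {}" and t: "t \<ge> 1" and C: "C > 0" and r: "r > 1" and rr': "1 / r + 1 / r' = 1"
    and \<gamma>: "\<gamma> \<ge> 0" and inf\<kappa>: "(INF j\<in>J. \<kappa> j) = 0"
    and fstar: "fstar \<in> subdifferential R fdag"
    using assms by auto
  have \<kappa>: "\<kappa> j > 0" and \<sigma>: "\<sigma> j > 0" if "j \<in> J" for j using assms that by auto
  \<comment> \<open>The sign of \<open>r'\<close> has to be extracted from the conjugacy relation: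
    \<open>1 / r'\<close> lies strictly between 0 and 1.\<close>
  have "1 / r < 1" "0 < 1 / r" using r by auto
  then have "0 < 1 / r'" "1 / r' < 1" using rr' by linarith+
  then have r': "r' > 1" by (simp add: field_simps split: if_splits)
  \<comment> \<open>Raising the radius to the power \<open>r - 1\<close> therefore recovers
    \<open>2 / C * norm fstar\<close>.\<close>
  have rr'1: "r' / r * (r - 1) = 1"
    using rr' r r' by (simp add: field_simps)
  let ?c = "\<lambda>j. 1 / r' * (2 / C) powr (r' / r) * (1 + \<gamma>) powr r' * \<kappa> j powr r'"
  let ?\<phi> = "\<lambda>j \<tau>. \<sigma> j * \<tau> powr (1 / t) + ?c j"
  let ?\<psi> = "psi_vsc J \<kappa> \<sigma> \<gamma> C r r' t"
  have c0: "0 \<le> ?c j" for j using r' by simp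

  have index: "concave_index_function ?\<psi>"
    unfolding psi_vsc_def[abs_def]
  proof (rule concave_index_function_INF[OF J])
    fix j assume j: "j \<in> J"
    have "concave_on {0..} (\<lambda>x::real. x powr (1 / t))" using t by (intro powr_concave) auto
    then show "concave_on {0..} (?\<phi> j)"
      using \<sigma>[OF j] by (intro concave_on_add concave_on_cmul) (use r' in \<open>auto simp: concave_on_const\<close>)
    show "continuous_on {0..} (?\<phi> j)"
      using t by (intro continuous_intros continuous_on_powr') auto
    show "mono_on {0..} (?\<phi> j)"
      using \<sigma>[OF j] t by (intro mono_onI add_right_mono mult_left_mono powr_mono2) auto
    show "0 \<le> ?\<phi> j x" for x using \<sigma>[OF j] c0[of j] by simp
  next
    fix e :: real assume e: "0 < e"
    define K where "K = 1 / r' * (2 / C) powr (r' / r) * (1 + \<gamma>) powr r'"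
    have K: "K > 0" using r' C \<gamma> by (simp add: K_def)
    \<comment> \<open>\<open>d\<close> solves \<open>K * d powr r' = e\<close>. Since
      \<open>0 powr (1 / t) = 0\<close>, the value \<open>?\<phi> j 0\<close> is just
      \<open>K * \<kappa> j powr r'\<close>, so \<open>\<kappa> j < d\<close> suffices.\<close>
    define d where "d = (e / K) powr (1 / r')"
    have "d > 0" using e K by (simp add: d_def)
    then obtain j where j: "j \<in> J" "\<kappa> j < d"
      using inf\<kappa> cINF_greatest[OF J, of d \<kappa>] by force
    have "\<kappa> j powr r' < d powr r'"
      using \<kappa>[OF j(1)] j(2) r' by (intro powr_less_mono2) auto
    also have "\<dots> = e / K" using e K r' by (simp add: d_def powr_powr)
    finally have "K * \<kappa> j powr r' < e" using K by (simp add: field_simps)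
    then show "\<exists>j\<in>J. ?\<phi> j 0 < e" using j(1) t by (auto simp: K_def)
  qed

  \<comment> \<open>Half the Bregman distance, possibly infinite, is first replaced by its real
    lower bound.\<close>
  have real_bound: "blinfun_apply fstar (fdag - f)
      \<le> C / 2 * norm (fdag - f) powr r + ?\<psi> (norm (F fdag - F f) powr t)"
    if f: "f \<in> D" for f
  proof (cases "norm (fdag - f) \<le> (2 / C * norm fstar) powr (r' / r)")
    case True
    let ?n = "norm (fdag - f)"
    \<comment> \<open>The power of \<open>?n\<close> does not depend on \<open>j\<close>; moving it
      to the left leaves exactly the expression whose infimum is \<open>?\<psi>\<close>.\<close>
    have "blinfun_apply fstar (fdag - f) - C / 2 * ?n powr r
        \<le> ?\<phi> j (norm (F fdag - F f) powr t)" if j: "j \<in> J" for j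
    proof -
      have "blinfun_apply fstar (fdag - f)
          = blinfun_apply (fstar - P j fstar) (fdag - f) + blinfun_apply (P j fstar) (fdag - f)"
        by (simp add: blinfun.diff_left)
      also have "blinfun_apply (fstar - P j fstar) (fdag - f) \<le> norm (fstar - P j fstar) * ?n"
        using norm_blinfun[of "fstar - P j fstar" "fdag - f"] by simp
      also have "\<dots> \<le> \<kappa> j * ?n" using assms(17)[OF j] by (intro mult_right_mono) auto
      also have "blinfun_apply (P j fstar) (fdag - f)
          \<le> \<sigma> j * norm (F fdag - F f) + \<gamma> * \<kappa> j * ?n"
        using assms(18)[OF j f True] .
      finally have "blinfun_apply fstar (fdag - f)
          \<le> \<sigma> j * norm (F fdag - F f) + ((1 + \<gamma>) * \<kappa> j) * ?n"
        by (simp add: algebra_simps)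
      moreover have "((1 + \<gamma>) * \<kappa> j) * ?n \<le> C / 2 * ?n powr r + ?c j"
        using Youngs_inequality_scaled[of r r' "C / 2" "(1 + \<gamma>) * \<kappa> j" ?n] r r' rr' C \<gamma> \<kappa>[OF j]
        by (simp add: powr_mult mult.assoc)
      moreover have "(norm (F fdag - F f) powr t) powr (1 / t) = norm (F fdag - F f)"
        using t by (simp add: powr_powr)
      ultimately show ?thesis by simp
    qed
    then have "blinfun_apply fstar (fdag - f) - C / 2 * ?n powr r
        \<le> ?\<psi> (norm (F fdag - F f) powr t)"
      unfolding psi_vsc_def by (intro cINF_greatest J)
    then show ?thesis by simp
  next
    case False
    let ?n = "norm (fdag - f)"
    have n: "?n > 0" using False by (smt (verit) powr_ge_zero)
    \<comment> \<open>The failed radius condition, raised to the power \<open>r - 1\<close>, bounds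
      \<open>norm fstar\<close> by a power of \<open>?n\<close>; one more factor \<open>?n\<close>
      completes the exponent \<open>r\<close>.\<close>
    have "2 / C * norm fstar = ((2 / C * norm fstar) powr (r' / r)) powr (r - 1)"
      using rr'1 C by (simp add: powr_powr)
    also have "\<dots> \<le> ?n powr (r - 1)"
      using False r by (intro powr_mono2) auto
    finally have "norm fstar \<le> C / 2 * ?n powr (r - 1)" using C by (simp add: field_simps)
    then have "norm fstar * ?n \<le> C / 2 * ?n powr (r - 1) * ?n"
      by (intro mult_right_mono) auto
    also have "\<dots> = C / 2 * ?n powr r" using n by (simp add: powr_diff)
    finally have "blinfun_apply fstar (fdag - f) \<le> C / 2 * ?n powr r"
      using norm_blinfun[of fstar "fdag - f"] by simp
    moreover have "0 \<le> ?\<psi> (norm (F fdag - F f) powr t)"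
      using index by (simp add: concave_index_function_def)
    ultimately show ?thesis by simp
  qed

  have "ereal (blinfun_apply fstar (fdag - f))
      \<le> ereal (1 / 2) * bregman_distance R f fdag
        + ereal (?\<psi> (norm (F fdag - F f) powr t))" if f: "f \<in> D" for f
  proof -
    have "ereal (C * norm (fdag - f) powr r) \<le> bregman_distance R f fdag"
      using assms(9) fstar by blast
    \<comment> \<open>The coercivity bound excludes \<open>-\<infinity>\<close>, and the value
      \<open>\<infinity>\<close> makes the claim trivial.\<close>
    then show ?thesis
      using real_bound[OF f] by (cases "bregman_distance R f fdag") auto
  qed
  with index show ?thesis by blast
qed

end
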